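(* Let $A\in\mathbb{R}^{n\times n}$, the initial preconditioner $\widehat P_0$, and the contraction constant $r<1$ be as in the context, and let $\delta_0>0$. Then there are a number $\delta>0$ and a constant $K$ such that the following holds. For every sequence $\{u_k\}$ of Newton iterates (with correction equation solved exactly, and satisfying the convergence assumption $\|e_{k+1}\|<r\|e_k\|$ for all $k\ge 0$) such that $\|E_0\|<\delta_0$ and $\|e_0\|<\delta$, one has $$\|E_{k+1}\|\le \|E_k\|+K\sqrt{\|e_k\|}\qquad\text{for all } k\ge 0 .$$
   Context: $A\in\mathbb{R}^{n\times n}$ is symmetric positive definite (SPD) with eigenvalues $\lambda_1<\lambda_2<\dots<\lambda_n$ and corresponding unit eigenvectors $v_1,\dots,v_n$. All vector norms are Euclidean and the norm of a symmetric matrix is the spectral norm. Newton iteration for the smallest eigenpair: $u_0$ is a unit vector; for $k\ge 0$, $\theta_k=u_k^\top A u_k$, $r_k=Au_k-\theta_k u_k$ (residual vector), and $$J_k=(I-u_ku_k^\top)(A-\theta_k I)(I-u_ku_k^\top).$$ The vector $s_k$ is the solution, orthogonal to $u_k$, of the correction equation $J_k s_k=-r_k$, and $u_{k+1}=(u_k+s_k)/\|u_k+s_k\|$. It is assumed that $s_k\neq 0$, so that the formulas below make sense. Set $e_k=u_k-v_1$. Standing assumption: convergence holds, i.e. there is a constant $r<1$ with $\|e_{k+1}\|<r\|e_k\|$ for all $k\ge0$. Preconditioners: $\widehat P_0=(LL^\top)^{-1}$, where $L$ is a nonsingular lower triangular (incomplete Cholesky) factor; thus $\widehat P_0$ is SPD.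 Recursively, $$\widehat P_{k+1}=-\frac{s_ks_k^\top}{s_k^\top r_k}+\Big(I-\frac{s_kr_k^\top}{s_k^\top r_k}\Big)\widehat P_k\Big(I-\frac{r_ks_k^\top}{s_k^\top r_k}\Big),\qquad P_k=(I-u_ku_k^\top)\widehat P_k(I-u_ku_k^\top).$$ For $u_k$ sufficiently close to $v_1$, $J_k$ is positive semidefinite (and positive definite on $u_k^\perp$), and $J_k^{1/2}$ denotes its positive semidefinite square root; in particular $J_k^{1/2}u_k=0$. Define $$E_k=I-J_k^{1/2}P_kJ_k^{1/2}=I-J_k^{1/2}\widehat P_kJ_k^{1/2}.$$ Convention: notions such as norm and positive definiteness for $J_k$, $P_k$, $E_k$ refer to the restriction to the subspace $u_k^\perp$ orthogonal to $u_k$; thus $\|E_k\|=\sup\{|z^\top E_kz| : z\perp u_k,\ \|z\|=1\}$. *)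

theory Defs
  imports "HOL-Analysis.Analysis"
begin

definition outer :: "real^'n \<Rightarrow> real^'n \<Rightarrow> real^'n^'n" where
  "outer x y = (\<chi> i j. x $ i * y $ j)"

definition symmetric_matrix :: "real^'n^'n \<Rightarrow> bool" where
  "symmetric_matrix M \<longleftrightarrow> transpose M = M"

definition spd :: "real^'n^'n \<Rightarrow> bool" where
  "spd M \<longleftrightarrow> symmetric_matrix M \<and> (\<forall>x. x \<noteq> 0 \<longrightarrow> 0 < x \<bullet> (M *v x))"

definition psd :: "real^'n^'n \<Rightarrow> bool" where
  "psd M \<longleftrightarrow> symmetric_matrix M \<and> (\<forall>x. 0 \<le> x \<bullet> (M *v x))"

definition lower_triangular :: "real^('n::{finite,linorder})^('n::{finite,linorder}) \<Rightarrow> bool" where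
  "lower_triangular M \<longleftrightarrow> (\<forall>i j. i < j \<longrightarrow> M $ i $ j = 0)"

text \<open>The positive semidefinite square root; meaningful only if \<open>M\<close> is positive semidefinite,
  in which case it exists and is unique.\<close>

definition psd_sqrt :: "real^'n^'n \<Rightarrow> real^'n^'n" where
  "psd_sqrt M = (THE B. psd B \<and> B ** B = M)"

definition proj_perp :: "real^'n \<Rightarrow> real^'n^'n" where
  "proj_perp u = mat 1 - outer u u"

text \<open>The spectral norm of the symmetric matrix \<open>M\<close> restricted to the orthogonal complement
  of \<open>u\<close>; meaningful only if that complement is nonzero, i.e. in dimension at least 2.\<close>

definition norm_perp :: "real^'n \<Rightarrow> real^'n^'n \<Rightarrow> real" where
  "norm_perp u M = Sup {\<bar>z \<bullet> (M *v z)\<bar> | z. z \<bullet> u = 0 \<and> norm z = 1}"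

definition rayleigh :: "real^'n^'n \<Rightarrow> real^'n \<Rightarrow> real" where
  "rayleigh A u = u \<bullet> (A *v u)"

definition residual :: "real^'n^'n \<Rightarrow> real^'n \<Rightarrow> real^'n" where
  "residual A u = A *v u - rayleigh A u *\<^sub>R u"

definition jac :: "real^'n^'n \<Rightarrow> real^'n \<Rightarrow> real^'n^'n" where
  "jac A u = proj_perp u ** (A - rayleigh A u *\<^sub>R mat 1) ** proj_perp u"

definition newton_iterates ::
  "real^'n^'n \<Rightarrow> (nat \<Rightarrow> real^'n) \<Rightarrow> (nat \<Rightarrow> real^'n) \<Rightarrow> bool" where
  "newton_iterates A u s \<longleftrightarrow>
     norm (u 0) = 1 \<and>
     (\<forall>k. s k \<bullet> u k = 0 \<and>
          jac A (u k) *v s k = - residual A (u k) \<and>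
          s k \<noteq> 0 \<and>
          u (Suc k) = (1 / norm (u k + s k)) *\<^sub>R (u k + s k))"

definition bfgs_update :: "real^'n \<Rightarrow> real^'n \<Rightarrow> real^'n^'n \<Rightarrow> real^'n^'n" where
  "bfgs_update s r P =
     - ((1 / (s \<bullet> r)) *\<^sub>R outer s s)
     + (mat 1 - (1 / (s \<bullet> r)) *\<^sub>R outer s r) ** P ** (mat 1 - (1 / (s \<bullet> r)) *\<^sub>R outer r s)"

primrec precond_hat ::
  "real^'n^'n \<Rightarrow> real^'n^'n \<Rightarrow> (nat \<Rightarrow> real^'n) \<Rightarrow> (nat \<Rightarrow> real^'n) \<Rightarrow> nat \<Rightarrow> real^'n^'n" where
  "precond_hat A L u s 0 = matrix_inv (L ** transpose L)"
| "precond_hat A L u s (Suc k) =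
     bfgs_update (s k) (residual A (u k)) (precond_hat A L u s k)"

definition precond ::
  "real^'n^'n \<Rightarrow> real^'n^'n \<Rightarrow> (nat \<Rightarrow> real^'n) \<Rightarrow> (nat \<Rightarrow> real^'n) \<Rightarrow> nat \<Rightarrow> real^'n^'n" where
  "precond A L u s k = proj_perp (u k) ** precond_hat A L u s k ** proj_perp (u k)"

definition precond_error ::
  "real^'n^'n \<Rightarrow> real^'n^'n \<Rightarrow> (nat \<Rightarrow> real^'n) \<Rightarrow> (nat \<Rightarrow> real^'n) \<Rightarrow> nat \<Rightarrow> real^'n^'n" where
  "precond_error A L u s k =
     mat 1 - psd_sqrt (jac A (u k)) ** precond A L u s k ** psd_sqrt (jac A (u k))"

definition precond_error_norm ::
  "real^'n^'n \<Rightarrow> real^'n^'n \<Rightarrow> (nat \<Rightarrow> real^'n) \<Rightarrow> (nat \<Rightarrow> real^'n) \<Rightarrow> nat \<Rightarrow> real" where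
  "precond_error_norm A L u s k = norm_perp (u k) (precond_error A L u s k)"

end

theory Submission
  imports Defs
begin

text \<open>
  The substitution \<open>z = J\<^sup>1\<^sup>/\<^sup>2 y\<close> shows that \<open>\<parallel>E\<parallel> \<le> c\<close> holds iff
  \<open>\<bar>y \<bullet> J y - J y \<bullet> P (J y)\<bar> \<le> c (y \<bullet> J y)\<close> for all \<open>y\<close> orthogonal to \<open>u\<close>, where \<open>P\<close> is
  the unprojected preconditioner. For fixed \<open>J = J\<^sub>k\<close> the update preserves this inequality,
  because \<open>r\<^sub>k = - J\<^sub>k s\<^sub>k\<close>. Replacing \<open>J\<^sub>k\<close> by \<open>J\<^sub>k\<^sub>+\<^sub>1\<close> costs a multiple of \<open>\<parallel>e\<^sub>k\<parallel>\<close>, since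
  \<open>J\<close> is Lipschitz in \<open>u\<close> and uniformly coercive on the complement of \<open>u\<close> near \<open>v\<^sub>1\<close>,
  provided that the \<open>P\<^sub>k\<close> are uniformly bounded. On the complement of \<open>u\<^sub>k\<close> they are bounded
  in terms of \<open>\<parallel>E\<^sub>k\<parallel>\<close>. In the direction \<open>u\<^sub>k\<close> the update changes nothing, so
  \<open>u\<^sub>k \<bullet> P\<^sub>k u\<^sub>k\<close> drifts only with \<open>u\<^sub>k\<close>. As \<open>\<parallel>e\<^sub>k\<parallel>\<close> decays geometrically, both bounds propagate
  to all \<open>k\<close>.
\<close>

section \<open>Matrix-vector algebra and symmetric matrices\<close>

lemma outer_mult_vec: "outer x y *v z = (y \<bullet> z) *\<^sub>R x"
  by (simp add: outer_def vec_eq_iff matrix_vector_mult_def inner_vec_def sum_distrib_left mult_ac)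

lemma inner_transpose_mult_vec:
  fixes M :: "real^'n^'n"
  shows "x \<bullet> (transpose M *v y) = (M *v x) \<bullet> y"
  by (metis dot_lmul_matrix inner_commute transpose_matrix_vector)

lemma symmetric_matrix_inner:
  assumes "symmetric_matrix M"
  shows "x \<bullet> (M *v y) = (M *v x) \<bullet> y"
  by (metis assms inner_transpose_mult_vec symmetric_matrix_def)

lemma symmetric_matrixI:
  assumes "\<And>x y. x \<bullet> (M *v y) = (M *v x) \<bullet> y"
  shows "symmetric_matrix M"
proof -
  have "transpose M *v y = M *v y" for y
    by (rule vector_eq_rdot[THEN iffD1]) (metis assms inner_commute inner_transpose_mult_vec)
  then show ?thesis
    by (simp add: symmetric_matrix_def matrix_eq)
qed

lemma symmetric_matrix_diff:
  "symmetric_matrix M \<Longrightarrow> symmetric_matrix N \<Longrightarrow> symmetric_matrix (M - N)"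
  by (rule symmetric_matrixI)
     (simp add: matrix_vector_mult_diff_rdistrib inner_diff_left inner_diff_right symmetric_matrix_inner)

lemma scaleR_mat_mult_vec: "(c *\<^sub>R mat 1 :: real^'n^'n) *v x = c *\<^sub>R x"
  by (simp add: scaleR_matrix_vector_assoc[symmetric])

lemma symmetric_matrix_scaleR_mat: "symmetric_matrix (c *\<^sub>R mat 1 :: real^'n^'n)"
  by (rule symmetric_matrixI) (simp add: scaleR_mat_mult_vec)

section \<open>Null vectors of nonnegative forms and the spectral theorem\<close>

text \<open>Along the line \<open>x + t *\<^sub>R y\<close> the form is
  \<open>2 * t * b + t\<^sup>2 * q\<close>, which takes negative values near \<open>t = 0\<close>
  unless \<open>b = 0\<close>. Nonnegativity is assumed on a subspace only, because the eigenvector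
  argument below has it only there.\<close>

lemma nonneg_form_null_orthogonal:
  fixes M :: "real^'n^'n"
  assumes sym: "symmetric_matrix M" and S: "subspace S"
    and nonneg: "\<And>z. z \<in> S \<Longrightarrow> 0 \<le> z \<bullet> (M *v z)"
    and x: "x \<in> S" and y: "y \<in> S" and null: "x \<bullet> (M *v x) = 0"
  shows "y \<bullet> (M *v x) = 0"
proof (rule ccontr)
  define b where "b = y \<bullet> (M *v x)"
  define q where "q = y \<bullet> (M *v y)"
  \<comment> \<open>The minimiser would be \<open>- b / q\<close>; the denominator
    \<open>q + 1\<close> also covers \<open>q = 0\<close> and still gives a negative value.\<close>
  define t where "t = - b / (q + 1)"
  assume "y \<bullet> (M *v x) \<noteq> 0"
  then have b: "b \<noteq> 0" by (simp add: b_def)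
  have q: "q \<ge> 0" using nonneg[OF y] by (simp add: q_def)
  have "0 \<le> (x + t *\<^sub>R y) \<bullet> (M *v (x + t *\<^sub>R y))"
    by (intro nonneg subspace_add subspace_scale S x y)
  also have "\<dots> = 2 * t * b + t\<^sup>2 * q"
    using null symmetric_matrix_inner[OF sym, of x y]
    by (simp add: b_def q_def matrix_vector_right_distrib matrix_vector_mult_scaleR
        inner_add_left inner_add_right inner_commute power2_eq_square algebra_simps)
  also have "\<dots> = - (b\<^sup>2 * (q + 2)) / (q + 1)\<^sup>2"
    using q by (simp add: t_def divide_simps) (simp add: power2_eq_square algebra_simps)
  also have "\<dots> < 0"
    using b q by (simp add: divide_neg_pos)
  finally show False by simp
qed

lemma psd_form_null:
  assumes "psd M" and "x \<bullet> (M *v x) = 0"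
  shows "M *v x = 0"
  using nonneg_form_null_orthogonal[of M UNIV x "M *v x"] assms
  by (simp add: psd_def)

text \<open>Let \<open>x\<close> maximise the form of \<open>M\<close> on the unit sphere of
  \<open>S\<close>, with value \<open>l\<close>. Then the form of
  \<open>l *\<^sub>R mat 1 - M\<close> is nonnegative on \<open>S\<close> and vanishes at
  \<open>x\<close>, so this matrix sends \<open>x\<close> to a vector orthogonal to
  \<open>S\<close>. By invariance that vector lies in \<open>S\<close>, hence it is zero.\<close>

lemma symmetric_matrix_eigenvector:
  fixes M :: "real^'n^'n"
  assumes sym: "symmetric_matrix M" and S: "subspace S"
    and inv: "\<And>x. x \<in> S \<Longrightarrow> M *v x \<in> S" and ne: "S \<noteq> {0}"
  obtains x l where "x \<in> S" "norm x = 1" "M *v x = l *\<^sub>R x"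
proof -
  obtain x0 where x0: "x0 \<in> S" "x0 \<noteq> 0"
    using ne subspace_0[OF S] by auto
  let ?T = "sphere 0 1 \<inter> S"
  have "(1 / norm x0) *\<^sub>R x0 \<in> ?T"
    using x0 S by (auto simp: subspace_scale)
  moreover have "compact ?T"
    by (intro compact_Int_closed closed_subspace S compact_sphere)
  moreover have "continuous_on ?T (\<lambda>x. x \<bullet> (M *v x))"
    by (intro continuous_intros)
  ultimately obtain x where x: "x \<in> ?T" and max: "\<And>y. y \<in> ?T \<Longrightarrow> y \<bullet> (M *v y) \<le> x \<bullet> (M *v x)"
    using continuous_attains_sup[of ?T "\<lambda>x. x \<bullet> (M *v x)"] by (metis empty_iff)
  define l where "l = x \<bullet> (M *v x)"
  let ?N = "l *\<^sub>R mat 1 - M"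
  have N: "?N *v z = l *\<^sub>R z - M *v z" for z
    by (simp add: matrix_vector_mult_diff_rdistrib scaleR_mat_mult_vec)
  have nonneg: "0 \<le> z \<bullet> (?N *v z)" if "z \<in> S" for z
  proof (cases "z = 0")
    case False
    then have "(1 / norm z) *\<^sub>R z \<in> ?T" using that S by (auto simp: subspace_scale)
    from max[OF this] False have "z \<bullet> (M *v z) \<le> l * (norm z)\<^sup>2"
      by (simp add: l_def matrix_vector_mult_scaleR field_simps power2_eq_square)
    then show ?thesis
      unfolding N by (simp add: inner_diff_right power2_norm_eq_inner)
  qed auto
  have "x \<bullet> (?N *v x) = 0"
    unfolding N using x by (simp add: inner_diff_right l_def norm_eq_1)
  moreover have "?N *v x \<in> S"
    unfolding N using x S inv by (simp add: subspace_diff subspace_scale)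
  moreover have "symmetric_matrix ?N"
    by (intro symmetric_matrix_diff symmetric_matrix_scaleR_mat sym)
  ultimately have "(?N *v x) \<bullet> (?N *v x) = 0"
    using nonneg_form_null_orthogonal[of ?N S x "?N *v x"] S nonneg x by auto
  then have "M *v x = l *\<^sub>R x" by (simp add: N)
  then show ?thesis using that x by auto
qed

text \<open>Induction on the dimension: split off one unit eigenvector; by symmetry its orthogonal
  complement within \<open>S\<close> is again invariant.\<close>

lemma symmetric_matrix_eigenbasis:
  fixes M :: "real^'n^'n"
  assumes sym: "symmetric_matrix M" and S: "subspace S"
    and inv: "\<And>x. x \<in> S \<Longrightarrow> M *v x \<in> S"
  shows "\<exists>B. finite B \<and> pairwise orthogonal B \<and> span B = S \<and>
           (\<forall>b\<in>B. norm b = 1 \<and> (\<exists>l. M *v b = l *\<^sub>R b))"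
  using S inv
proof (induction "dim S" arbitrary: S rule: less_induct)
  case less
  show ?case
  proof (cases "S = {0}")
    case True
    then show ?thesis by (intro exI[of _ "{}"]) auto
  next
    case False
    then obtain x l where x: "x \<in> S" "norm x = 1" "M *v x = l *\<^sub>R x"
      using symmetric_matrix_eigenvector[OF sym less.prems] by blast
    define S' where "S' = S \<inter> {y. x \<bullet> y = 0}"
    have S': "subspace S'"
      unfolding S'_def by (intro subspace_inter less.prems subspace_hyperplane)
    have inv': "M *v y \<in> S'" if "y \<in> S'" for y
      using that less.prems(2) x symmetric_matrix_inner[OF sym, of x y]
      by (simp add: S'_def)
    have "x \<notin> S'" using x by (auto simp: S'_def)
    then have "S' \<subset> S" using x(1) by (metis S'_def inf_le1 psubsetI)
    then have "dim S' < dim S"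
      using dim_psubset[of S' S] S' less.prems(1) by (metis span_eq_iff)
    from less.hyps[OF this S' inv'] obtain B where
      B: "finite B" "pairwise orthogonal B" "span B = S'"
         "\<And>b. b \<in> B \<Longrightarrow> norm b = 1 \<and> (\<exists>l. M *v b = l *\<^sub>R b)" by blast
    have Bx: "x \<bullet> b = 0" if "b \<in> B" for b
      using that B(3) span_base[of b B] by (auto simp: S'_def)
    have "span (insert x B) = S"
    proof
      show "span (insert x B) \<subseteq> S"
        using B(3) span_superset[of B] x(1) less.prems(1)
        by (intro span_minimal) (auto simp: S'_def)
      show "S \<subseteq> span (insert x B)"
      proof
        fix y assume "y \<in> S"
        then have "y - (x \<bullet> y) *\<^sub>R x \<in> span B"
          using x less.prems(1) unfolding B(3) S'_def
          by (auto simp: subspace_diff subspace_scale inner_diff_right power2_norm_eq_inner[symmetric])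
        then show "y \<in> span (insert x B)"
          by (auto simp: span_insert)
      qed
    qed
    then show ?thesis
      using B x Bx
      by (intro exI[of _ "insert x B"])
         (auto simp: pairwise_insert orthogonal_def inner_commute)
  qed
qed

section \<open>The positive semidefinite square root\<close>

text \<open>Take square roots of the eigenvalues in an orthonormal eigenbasis; \<open>B ** B\<close>
  and \<open>M\<close> then need comparing on the basis only.\<close>

lemma psd_sqrt_exists:
  assumes "psd M"
  shows "\<exists>B. psd B \<and> B ** B = M"
proof -
  obtain E where E: "finite E" "pairwise orthogonal E" "span E = (UNIV :: (real^'a) set)"
    and E': "\<forall>b\<in>E. norm b = 1 \<and> (\<exists>l. M *v b = l *\<^sub>R b)"
    using symmetric_matrix_eigenbasis[of M UNIV] assms by (auto simp: psd_def)
  then obtain l where l: "\<And>b. b \<in> E \<Longrightarrow> M *v b = l b *\<^sub>R b" by metis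
  have lnn: "l b \<ge> 0" if "b \<in> E" for b
    using assms l[OF that] E' that unfolding psd_def
    by (metis inner_scaleR_right mult.right_neutral norm_eq_1)
  define f where "f x = (\<Sum>b\<in>E. (sqrt (l b) * (b \<bullet> x)) *\<^sub>R b)" for x
  define B where "B = matrix f"
  have "linear f"
    unfolding f_def by (intro linear_compose_sum ballI linearI)
      (auto simp: inner_add_right algebra_simps)
  then have B: "B *v x = f x" for x by (simp add: B_def matrix_works)
  have fb: "f b = sqrt (l b) *\<^sub>R b" if "b \<in> E" for b
  proof -
    have "f b = (\<Sum>c\<in>E. if c = b then sqrt (l b) *\<^sub>R b else 0)"
      unfolding f_def using E(2) E' that
      by (intro sum.cong refl) (auto simp: pairwise_def orthogonal_def norm_eq_1)
    then show ?thesis using that E(1) by simp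
  qed
  have "(B ** B) *v x = M *v x" for x
  proof (rule linear_eq_on_span[where B = E and f = "(*v) (B ** B)" and g = "(*v) M"])
    show "(B ** B) *v b = M *v b" if "b \<in> E" for b
      using fb[OF that] l[OF that] lnn[OF that]
      by (simp add: matrix_vector_mul_assoc[symmetric] B linear_scale[OF \<open>linear f\<close>])
  qed (use E in auto)
  then have "B ** B = M" by (simp add: matrix_eq)
  moreover have "symmetric_matrix B"
    by (rule symmetric_matrixI)
       (simp add: B f_def inner_sum_left inner_sum_right inner_commute mult_ac)
  moreover have "0 \<le> x \<bullet> (B *v x)" for x
    unfolding B f_def inner_sum_right using lnn
    by (intro sum_nonneg) (simp add: inner_commute mult.assoc)
  ultimately show ?thesis by (auto simp: psd_def)
qed

text \<open>If \<open>B\<^sup>2 = C\<^sup>2\<close>, then an eigenvector of \<open>B - C\<close> for a nonzero eigenvalue is null for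
  the form of \<open>B + C\<close>, since \<open>(B - C)(B + C) + (B + C)(B - C) = 0\<close>.\<close>

lemma psd_sqrt_unique:
  fixes B C :: "real^'n^'n"
  assumes B: "psd B" and C: "psd C" and eq: "B ** B = C ** C"
  shows "B = C"
proof -
  let ?D = "B - C"
  have symB: "symmetric_matrix B" and symC: "symmetric_matrix C"
    using B C by (auto simp: psd_def)
  obtain E where E: "span E = (UNIV :: (real^'n) set)"
    and E': "\<And>b. b \<in> E \<Longrightarrow> norm b = 1 \<and> (\<exists>l. ?D *v b = l *\<^sub>R b)"
    using symmetric_matrix_eigenbasis[of ?D UNIV] symmetric_matrix_diff[OF symB symC] by auto
  have zero: "?D *v b = 0" if "b \<in> E" for b
  proof (cases "?D *v b = 0")
    case False
    obtain l where l: "?D *v b = l *\<^sub>R b" using E'[OF \<open>b \<in> E\<close>] by blast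
    with False have "l \<noteq> 0" by auto
    have Bb: "B *v b = C *v b + l *\<^sub>R b"
      using l by (simp add: matrix_vector_mult_diff_rdistrib algebra_simps)
    have "(B *v b) \<bullet> (B *v b) = (C *v b) \<bullet> (C *v b)"
      using arg_cong[OF eq, of "\<lambda>M. b \<bullet> (M *v b)"]
        symmetric_matrix_inner[OF symB] symmetric_matrix_inner[OF symC]
      by (simp add: matrix_vector_mul_assoc[symmetric])
    then have "l * (b \<bullet> (C *v b) + b \<bullet> (B *v b)) = 0"
      unfolding Bb by (simp add: inner_add_left inner_add_right inner_commute algebra_simps)
    with \<open>l \<noteq> 0\<close> have "b \<bullet> (C *v b) + b \<bullet> (B *v b) = 0" by simp
    \<comment> \<open>Both summands are nonnegative, so both vanish; a positive semidefinite matrix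
      annihilates the null vectors of its form.\<close>
    then have "b \<bullet> (C *v b) = 0" "b \<bullet> (B *v b) = 0"
      using B C by (auto simp: psd_def add_nonneg_eq_0_iff)
    then show ?thesis
      by (simp add: psd_form_null[OF B] psd_form_null[OF C] matrix_vector_mult_diff_rdistrib)
  qed auto
  have "?D *v x = 0" for x
    by (rule linear_eq_on_span[where B = E and f = "(*v) ?D" and g = "\<lambda>_. 0"])
       (use E zero in \<open>auto intro: linear_zero\<close>)
  then show ?thesis
    by (simp add: matrix_eq matrix_vector_mult_diff_rdistrib)
qed

lemma psd_sqrt_works:
  assumes "psd M"
  shows "psd (psd_sqrt M)" and "psd_sqrt M ** psd_sqrt M = M"
proof -
  have "\<exists>!B. psd B \<and> B ** B = M"
    using psd_sqrt_exists[OF assms] psd_sqrt_unique by blast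
  from theI'[OF this] show "psd (psd_sqrt M)" and "psd_sqrt M ** psd_sqrt M = M"
    by (simp_all add: psd_sqrt_def)
qed

section \<open>The projected Jacobian\<close>

lemma proj_perp_mult_vec: "proj_perp u *v y = y - (u \<bullet> y) *\<^sub>R u"
  by (simp add: proj_perp_def matrix_vector_mult_diff_rdistrib outer_mult_vec)

lemma inner_proj_perp_mult_vec: "x \<bullet> (proj_perp u *v y) = (proj_perp u *v x) \<bullet> y"
  by (simp add: proj_perp_mult_vec inner_diff_left inner_diff_right inner_commute)

lemma jac_mult_vec:
  "jac A u *v y = proj_perp u *v (A *v (proj_perp u *v y) - rayleigh A u *\<^sub>R (proj_perp u *v y))"
  by (simp only: jac_def matrix_vector_mul_assoc[symmetric] matrix_vector_mult_diff_rdistrib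
      scaleR_mat_mult_vec)

lemma symmetric_jac:
  assumes "symmetric_matrix A"
  shows "symmetric_matrix (jac A u)"
  by (rule symmetric_matrixI)
     (simp add: jac_mult_vec inner_proj_perp_mult_vec inner_diff_left inner_diff_right
       symmetric_matrix_inner[OF assms] matrix_vector_mult_diff_distrib matrix_vector_mult_scaleR)

lemma jac_mult_self:
  assumes "norm u = 1"
  shows "jac A u *v u = 0"
  using assms by (simp add: jac_mult_vec proj_perp_mult_vec norm_eq_1)

lemma inner_jac_self:
  assumes "norm u = 1"
  shows "u \<bullet> (jac A u *v y) = 0"
  using assms by (simp add: jac_mult_vec proj_perp_mult_vec norm_eq_1 inner_diff_right)

lemma jac_form_perp:
  assumes "y \<bullet> u = 0"
  shows "y \<bullet> (jac A u *v y) = y \<bullet> (A *v y) - rayleigh A u * (norm y)\<^sup>2"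
  using assms
  by (simp add: jac_mult_vec proj_perp_mult_vec inner_diff_right inner_commute[of u y]
      power2_norm_eq_inner)

text \<open>The form of \<open>jac A u\<close> at \<open>x\<close> equals its value at the
  projection of \<open>x\<close>, so nonnegativity on the complement of \<open>u\<close> extends to
  the whole space, where \<open>psd_sqrt\<close> requires it.\<close>

lemma psd_jac:
  assumes A: "symmetric_matrix A" and u: "norm u = 1"
    and nonneg: "\<And>y. y \<bullet> u = 0 \<Longrightarrow> 0 \<le> y \<bullet> (jac A u *v y)"
  shows "psd (jac A u)"
proof -
  have "x \<bullet> (jac A u *v x) = (proj_perp u *v x) \<bullet> (jac A u *v (proj_perp u *v x))" for x
    using u by (simp add: proj_perp_mult_vec matrix_vector_mult_diff_distrib
        matrix_vector_mult_scaleR jac_mult_self inner_jac_self inner_diff_left)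
  moreover have "(proj_perp u *v x) \<bullet> u = 0" for x
    using u by (simp add: proj_perp_mult_vec inner_diff_left norm_eq_1 inner_commute[of u x])
  ultimately show ?thesis
    using nonneg symmetric_jac[OF A] unfolding psd_def by metis
qed

text \<open>Adding the rank-one term \<open>(y \<bullet> u) *\<^sub>R u\<close> makes the map
  injective on the whole space, hence surjective by finite dimension. It preserves the component
  along \<open>u\<close>, so preimages of vectors orthogonal to \<open>u\<close> are orthogonal to
  \<open>u\<close>. Applied below both to \<open>J\<close> and to its square root.\<close>

lemma perp_preimage:
  fixes M :: "real^'n^'n"
  assumes M: "symmetric_matrix M" and u: "norm u = 1" "M *v u = 0"
    and inj: "\<And>y. y \<bullet> u = 0 \<Longrightarrow> M *v y = 0 \<Longrightarrow> y = 0"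
    and z: "z \<bullet> u = 0"
  obtains y where "y \<bullet> u = 0" "M *v y = z"
proof -
  define f where "f y = M *v y + (y \<bullet> u) *\<^sub>R u" for y
  have uf: "u \<bullet> f y = y \<bullet> u" for y
    using u symmetric_matrix_inner[OF M, of u y] by (simp add: f_def inner_add_right norm_eq_1)
  have lin: "linear f"
    unfolding f_def by (intro linearI)
      (simp_all add: matrix_vector_right_distrib matrix_vector_mult_scaleR inner_add_left algebra_simps)
  moreover have "inj f"
    unfolding linear_injective_0[OF lin]
  proof (intro allI impI)
    fix y assume y: "f y = 0"
    then have "y \<bullet> u = 0" using uf[of y] by simp
    then show "y = 0" using y inj by (simp add: f_def)
  qed
  ultimately have "surj f" by (simp add: linear_injective_imp_surjective)
  then obtain y where y: "f y = z" by (metis surjD)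
  then have "y \<bullet> u = 0" using uf[of y] z by (simp add: inner_commute)
  then show ?thesis using that y by (simp add: f_def)
qed

section \<open>The error norm as an inequality between quadratic forms\<close>

context
  fixes J P :: "real^'n^'n" and u :: "real^'n" and E
  assumes J: "psd J" and u: "norm u = 1" and Ju: "J *v u = 0"
  defines "E \<equiv> mat 1 - psd_sqrt J ** (proj_perp u ** P ** proj_perp u) ** psd_sqrt J"
begin

lemma psd_sqrt_null: "psd_sqrt J *v u = 0"
proof -
  let ?B = "psd_sqrt J"
  have "(?B *v u) \<bullet> (?B *v u) = u \<bullet> ((?B ** ?B) *v u)"
    using psd_sqrt_works(1)[OF J] symmetric_matrix_inner[of ?B u "?B *v u"]
    by (simp add: psd_def matrix_vector_mul_assoc)
  then show ?thesis using Ju psd_sqrt_works(2)[OF J] by simp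
qed

text \<open>The substitution by the square root. The projectors disappear because
  \<open>J *v y\<close> is already orthogonal to \<open>u\<close>.\<close>

lemma error_form_sqrt:
  "(psd_sqrt J *v y) \<bullet> (E *v (psd_sqrt J *v y)) = y \<bullet> (J *v y) - (J *v y) \<bullet> (P *v (J *v y))"
  "(psd_sqrt J *v y) \<bullet> (psd_sqrt J *v y) = y \<bullet> (J *v y)"
  "(psd_sqrt J *v y) \<bullet> u = 0"
proof -
  let ?B = "psd_sqrt J"
  have sym: "a \<bullet> (?B *v b) = (?B *v a) \<bullet> b" for a b
    using psd_sqrt_works(1)[OF J] by (simp add: psd_def symmetric_matrix_inner)
  have BB: "?B *v (?B *v a) = J *v a" for a
    using psd_sqrt_works(2)[OF J] by (simp add: matrix_vector_mul_assoc)
  show *: "(?B *v y) \<bullet> (?B *v y) = y \<bullet> (J *v y)"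
    by (simp add: BB flip: sym)
  show "(?B *v y) \<bullet> u = 0"
    using sym[of y u] by (simp add: psd_sqrt_null)
  have "u \<bullet> (J *v y) = 0"
    using J Ju by (simp add: psd_def symmetric_matrix_inner)
  then have "proj_perp u *v (J *v y) = J *v y"
    by (simp add: proj_perp_mult_vec)
  then show "(?B *v y) \<bullet> (E *v (?B *v y)) = y \<bullet> (J *v y) - (J *v y) \<bullet> (P *v (J *v y))"
    unfolding E_def
    by (simp add: matrix_vector_mult_diff_rdistrib inner_diff_right * BB sym[of "?B *v y"]
        inner_proj_perp_mult_vec inner_commute[of y] flip: matrix_vector_mul_assoc)
qed

lemma norm_perp_error_bound:
  "\<bar>y \<bullet> (J *v y) - (J *v y) \<bullet> (P *v (J *v y))\<bar> \<le> norm_perp u E * (y \<bullet> (J *v y))"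
proof (cases "psd_sqrt J *v y = 0")
  case True
  then have "J *v y = 0"
    using psd_sqrt_works(2)[OF J] by (metis matrix_vector_mul_assoc matrix_vector_mult_0_right)
  then show ?thesis by simp
next
  case False
  define z where "z = psd_sqrt J *v y"
  let ?S = "{\<bar>z \<bullet> (E *v z)\<bar> | z. z \<bullet> u = 0 \<and> norm z = 1}"
  \<comment> \<open>A real \<open>Sup\<close> dominates the members of a set only if the set is
    bounded above; the operator norm of \<open>E\<close> is such a bound.\<close>
  have "bdd_above ?S"
  proof (rule bdd_aboveI)
    fix a assume "a \<in> ?S"
    then obtain z where z: "norm z = 1" "a = \<bar>z \<bullet> (E *v z)\<bar>" by auto
    have "norm (E *v z) \<le> onorm ((*v) E)"
      using onorm[of "(*v) E" z] z by simp
    then show "a \<le> onorm ((*v) E)"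
      using Cauchy_Schwarz_ineq2[of z "E *v z"] z by simp
  qed
  moreover have "\<bar>((1 / norm z) *\<^sub>R z) \<bullet> (E *v ((1 / norm z) *\<^sub>R z))\<bar> \<in> ?S"
  proof -
    have "((1 / norm z) *\<^sub>R z) \<bullet> u = 0 \<and> norm ((1 / norm z) *\<^sub>R z) = 1"
      using error_form_sqrt(3)[of y] False by (simp add: z_def)
    then show ?thesis by blast
  qed
  ultimately have "\<bar>((1 / norm z) *\<^sub>R z) \<bullet> (E *v ((1 / norm z) *\<^sub>R z))\<bar> \<le> norm_perp u E"
    unfolding norm_perp_def by (rule cSup_upper[rotated])
  then have "\<bar>z \<bullet> (E *v z)\<bar> \<le> norm_perp u E * (z \<bullet> z)"
    using False
    by (simp add: z_def[symmetric] matrix_vector_mult_scaleR abs_mult field_simps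
        power2_norm_eq_inner[symmetric] power2_eq_square)
  then show ?thesis
    unfolding z_def error_form_sqrt .
qed

text \<open>Converse direction: definiteness on the complement makes the square root surjective
  there, so every unit \<open>z\<close> in the supremum comes from some \<open>y\<close>. The vector
  \<open>x\<close> ensures that the supremum is over a nonempty set.\<close>

lemma norm_perp_error_le:
  assumes pos: "\<And>y. y \<bullet> u = 0 \<Longrightarrow> y \<noteq> 0 \<Longrightarrow> 0 < y \<bullet> (J *v y)"
    and x: "x \<bullet> u = 0" "x \<noteq> 0"
    and bound: "\<And>y. y \<bullet> u = 0 \<Longrightarrow>
      \<bar>y \<bullet> (J *v y) - (J *v y) \<bullet> (P *v (J *v y))\<bar> \<le> c * (y \<bullet> (J *v y))"
  shows "norm_perp u E \<le> c"
  unfolding norm_perp_def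
proof (rule cSup_least)
  have "((1 / norm x) *\<^sub>R x) \<bullet> u = 0 \<and> norm ((1 / norm x) *\<^sub>R x) = 1"
    using x by simp
  then show "{\<bar>z \<bullet> (E *v z)\<bar> | z. z \<bullet> u = 0 \<and> norm z = 1} \<noteq> {}" by blast
  fix a assume "a \<in> {\<bar>z \<bullet> (E *v z)\<bar> | z. z \<bullet> u = 0 \<and> norm z = 1}"
  then obtain z where z: "z \<bullet> u = 0" "norm z = 1" "a = \<bar>z \<bullet> (E *v z)\<bar>" by auto
  have "y = 0" if "y \<bullet> u = 0" "psd_sqrt J *v y = 0" for y
    using pos[OF that(1)] error_form_sqrt(2)[of y] that(2) by fastforce
  then obtain y where y: "y \<bullet> u = 0" "psd_sqrt J *v y = z"
    using perp_preimage[of "psd_sqrt J" u z] psd_sqrt_works(1)[OF J] u psd_sqrt_null z(1)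
    by (metis psd_def)
  have "a \<le> c * (z \<bullet> z)"
    using bound[OF y(1)] error_form_sqrt(1,2)[of y] y(2) z(3) by simp
  then show "a \<le> c" using z(2) by (simp add: norm_eq_1)
qed

end

section \<open>The preconditioner update\<close>

text \<open>The outer factors of the update are transposes of each other, so \<open>P\<close> is
  evaluated at two vectors shifted along \<open>r\<close>. The bilinear version yields symmetry of
  the update as well as its quadratic form.\<close>

lemma bfgs_form:
  fixes P :: "real^'n^'n"
  shows "x \<bullet> (bfgs_update s r P *v x') =
    - ((s \<bullet> x) * (s \<bullet> x')) / (s \<bullet> r) +
    (x - ((s \<bullet> x) / (s \<bullet> r)) *\<^sub>R r) \<bullet> (P *v (x' - ((s \<bullet> x') / (s \<bullet> r)) *\<^sub>R r))"
proof -
  define c where "c = 1 / (s \<bullet> r)"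
  have L: "a \<bullet> ((mat 1 - c *\<^sub>R outer s r) *v b) = (a - (c * (s \<bullet> a)) *\<^sub>R r) \<bullet> b" for a b
    by (simp add: matrix_vector_mult_diff_rdistrib scaleR_matrix_vector_assoc[symmetric]
        outer_mult_vec inner_diff_left inner_diff_right inner_commute)
  have R: "(mat 1 - c *\<^sub>R outer r s) *v b = b - (c * (s \<bullet> b)) *\<^sub>R r" for b
    by (simp add: matrix_vector_mult_diff_rdistrib scaleR_matrix_vector_assoc[symmetric]
        outer_mult_vec)
  have neg: "(- (c *\<^sub>R outer s s)) *v x' = - ((c * (s \<bullet> x')) *\<^sub>R s)"
    using matrix_vector_mult_diff_rdistrib[of 0 "c *\<^sub>R outer s s" x']
    by (simp add: scaleR_matrix_vector_assoc[symmetric] outer_mult_vec)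
  have "x \<bullet> (bfgs_update s r P *v x') = - (c * ((s \<bullet> x) * (s \<bullet> x'))) +
      (x - (c * (s \<bullet> x)) *\<^sub>R r) \<bullet> (P *v (x' - (c * (s \<bullet> x')) *\<^sub>R r))"
    unfolding bfgs_update_def c_def[symmetric] matrix_vector_mult_add_rdistrib
      matrix_vector_mul_assoc[symmetric] R neg inner_add_right L
    by (simp add: inner_commute[of x s])
  then show ?thesis by (simp add: c_def)
qed

text \<open>For \<open>s \<bullet> r < 0\<close> the rank-one term contributes a nonnegative square,
  and the rest is the form of \<open>P\<close> at a shifted vector. The sign condition holds for
  \<open>r = - J s\<close> when \<open>s\<close> has positive \<open>J\<close>-form.\<close>

lemma psd_bfgs_update:
  assumes "psd P" and "s \<bullet> r < 0"
  shows "psd (bfgs_update s r P)"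
proof -
  have "symmetric_matrix (bfgs_update s r P)"
  proof (rule symmetric_matrixI)
    fix x y
    have "a \<bullet> (P *v b) = b \<bullet> (P *v a)" for a b
      using assms(1) by (metis inner_commute psd_def symmetric_matrix_inner)
    then show "x \<bullet> (bfgs_update s r P *v y) = (bfgs_update s r P *v x) \<bullet> y"
      unfolding inner_commute[of "bfgs_update s r P *v x"] bfgs_form by (simp add: mult.commute)
  qed
  moreover have "0 \<le> x \<bullet> (bfgs_update s r P *v x)" for x
    unfolding bfgs_form
    by (rule add_nonneg_nonneg, rule divide_nonpos_neg) (use assms in \<open>auto simp: psd_def\<close>)
  ultimately show ?thesis by (simp add: psd_def)
qed

text \<open>For a secant pair \<open>r = - J s\<close>, splitting \<open>y\<close> into a multiple of \<open>s\<close> and a \<open>J\<close>-orthogonal part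
  shows that the update is exact along \<open>s\<close> and leaves the rest unchanged.\<close>

lemma bfgs_secant_error:
  fixes J P :: "real^'n^'n"
  assumes J: "psd J" and s: "0 < s \<bullet> (J *v s)" and c: "0 \<le> c"
    and bound: "\<And>y. \<bar>y \<bullet> (J *v y) - (J *v y) \<bullet> (P *v (J *v y))\<bar> \<le> c * (y \<bullet> (J *v y))"
  shows "\<bar>y \<bullet> (J *v y) - (J *v y) \<bullet> (bfgs_update s (- (J *v s)) P *v (J *v y))\<bar>
    \<le> c * (y \<bullet> (J *v y))"
proof -
  define w where "w = s \<bullet> (J *v s)"
  define a where "a = s \<bullet> (J *v y) / w"
  define z where "z = y - a *\<^sub>R s"
  have w: "w > 0" using s by (simp add: w_def)
  have sym: "y \<bullet> (J *v s) = s \<bullet> (J *v y)"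
    using J by (metis inner_commute psd_def symmetric_matrix_inner)
  have Jz: "J *v z = J *v y - a *\<^sub>R (J *v s)"
    by (simp add: z_def matrix_vector_mult_diff_distrib matrix_vector_mult_scaleR)
  have sy: "s \<bullet> (J *v y) = a * w" using w by (simp add: a_def)
  have y: "y \<bullet> (J *v y) = a\<^sup>2 * w + z \<bullet> (J *v z)"
    unfolding Jz by (simp add: z_def inner_diff_left inner_diff_right sym sy w_def[symmetric]
        power2_eq_square algebra_simps)
  \<comment> \<open>For \<open>r = - J s\<close> the shift turns \<open>J *v y\<close> into
    \<open>J *v z\<close>, and the rank-one term equals \<open>a\<^sup>2 * w\<close>, which cancels
    against the same term in \<open>y \<bullet> (J *v y)\<close>.\<close>
  have "(J *v y) \<bullet> (bfgs_update s (- (J *v s)) P *v (J *v y))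
      = a\<^sup>2 * w + (J *v z) \<bullet> (P *v (J *v z))"
    using w by (simp add: bfgs_form Jz sy w_def[symmetric] power2_eq_square)
  then have "\<bar>y \<bullet> (J *v y) - (J *v y) \<bullet> (bfgs_update s (- (J *v s)) P *v (J *v y))\<bar>
      = \<bar>z \<bullet> (J *v z) - (J *v z) \<bullet> (P *v (J *v z))\<bar>"
    by (simp add: y)
  also have "\<dots> \<le> c * (z \<bullet> (J *v z))" by (rule bound)
  also have "\<dots> \<le> c * (y \<bullet> (J *v y))"
    unfolding y using w c by (intro mult_left_mono) auto
  finally show ?thesis .
qed

section \<open>Estimates for positive semidefinite forms and the initial preconditioner\<close>

lemma symmetric_form_diff:
  assumes "symmetric_matrix P"
  shows "x \<bullet> (P *v x) - y \<bullet> (P *v y) = (x - y) \<bullet> (P *v (x + y))"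
  using symmetric_matrix_inner[OF assms, of x y]
  by (simp add: matrix_vector_right_distrib inner_diff_left inner_add_right inner_commute[of y])

text \<open>Parallelogram law with the nonnegative value at \<open>x - y\<close> dropped.\<close>

lemma psd_form_add_le:
  assumes "psd P"
  shows "(x + y) \<bullet> (P *v (x + y)) \<le> 2 * (x \<bullet> (P *v x)) + 2 * (y \<bullet> (P *v y))"
proof -
  have "0 \<le> (x - y) \<bullet> (P *v (x - y))" using assms by (simp add: psd_def)
  then show ?thesis
    by (simp add: matrix_vector_right_distrib matrix_vector_mult_diff_distrib
        inner_diff_left inner_add_left inner_diff_right inner_add_right)
qed

text \<open>For unit vectors, nonnegativity of the form at \<open>a + b\<close> and
  \<open>a - b\<close> bounds the mixed term by the mean of the two diagonal terms; the general case
  follows by scaling.\<close>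

lemma psd_bilinear_bound:
  assumes P: "psd P" and N: "\<And>x. x \<bullet> (P *v x) \<le> N * (norm x)\<^sup>2"
  shows "\<bar>x \<bullet> (P *v y)\<bar> \<le> N * norm x * norm y"
proof -
  have unit: "\<bar>a \<bullet> (P *v b)\<bar> \<le> N" if "norm a = 1" "norm b = 1" for a b
  proof -
    have sym: "b \<bullet> (P *v a) = a \<bullet> (P *v b)"
      using P by (metis inner_commute psd_def symmetric_matrix_inner)
    have bounds: "a \<bullet> (P *v a) \<le> N" "b \<bullet> (P *v b) \<le> N"
      using N[of a] N[of b] that by simp_all
    have "0 \<le> (a - b) \<bullet> (P *v (a - b))" "0 \<le> (a + b) \<bullet> (P *v (a + b))"
      using P by (simp_all add: psd_def)
    then show ?thesis
      using sym bounds
      by (simp add: matrix_vector_right_distrib matrix_vector_mult_diff_distrib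
          inner_diff_left inner_add_left inner_diff_right inner_add_right)
  qed
  show ?thesis
  proof (cases "x = 0 \<or> y = 0")
    case False
    then have "\<bar>((1 / norm x) *\<^sub>R x) \<bullet> (P *v ((1 / norm y) *\<^sub>R y))\<bar> \<le> N"
      by (intro unit) auto
    then show ?thesis
      using False by (simp add: matrix_vector_mult_scaleR abs_mult field_simps)
  qed auto
qed

lemma psd_form_diff_bound:
  assumes P: "psd P" and N: "\<And>x. x \<bullet> (P *v x) \<le> N * (norm x)\<^sup>2"
  shows "\<bar>x \<bullet> (P *v x) - y \<bullet> (P *v y)\<bar> \<le> N * norm (x - y) * norm (x + y)"
  using psd_bilinear_bound[OF assms, of "x - y" "x + y"] symmetric_form_diff[of P x y] P
  by (simp add: psd_def)

text \<open>Writing \<open>x\<close> as \<open>L ** transpose L\<close> applied to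
  \<open>?P *v x\<close> turns the form of the inverse into the squared norm of
  \<open>transpose L *v (?P *v x)\<close>.\<close>

lemma psd_inverse_mult_transpose:
  fixes L :: "real^'n^'n"
  assumes "invertible L"
  shows "psd (matrix_inv (L ** transpose L))"
proof -
  let ?M = "L ** transpose L" and ?P = "matrix_inv (L ** transpose L)"
  have "invertible ?M"
    using assms by (intro invertible_mult) (auto simp: transpose_invertible)
  then have "?M ** ?P = mat 1" 
    unfolding invertible_def matrix_inv_def by (rule someI2_ex) blast
  then have MP: "?M *v (?P *v x) = x" for x
    by (simp add: matrix_vector_mul_assoc)
  have M: "a \<bullet> (?M *v b) = (transpose L *v a) \<bullet> (transpose L *v b)" for a b
    using inner_transpose_mult_vec[of a "transpose L" "transpose L *v b"]
    by (simp only: transpose_transpose matrix_vector_mul_assoc[symmetric])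
  have P: "x \<bullet> (?P *v y) = (transpose L *v (?P *v x)) \<bullet> (transpose L *v (?P *v y))" for x y
    using M[of "?P *v y" "?P *v x"] unfolding MP by (simp only: inner_commute)
  have "symmetric_matrix ?P"
    by (rule symmetric_matrixI) (metis P inner_commute)
  moreover have "0 \<le> x \<bullet> (?P *v x)" for x
    unfolding P by (rule inner_ge_zero)
  ultimately show ?thesis by (simp add: psd_def)
qed

section \<open>Spectral gap and coercivity of the Jacobian\<close>

text \<open>Distinct eigenvalues make the eigenvectors orthogonal, so by counting they form an
  orthonormal basis that diagonalises the form. Orthogonality to \<open>v 1\<close> removes the
  smallest eigenvalue from the sum.\<close>

lemma eigenvalue_gap:
  fixes A :: "real^'n^'n" and v :: "nat \<Rightarrow> real^'n"
  assumes A: "symmetric_matrix A" and lam: "strict_mono_on {1..CARD('n)} lam"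
    and eig: "\<And>i. i \<in> {1..CARD('n)} \<Longrightarrow> A *v v i = lam i *\<^sub>R v i"
    and unit: "\<And>i. i \<in> {1..CARD('n)} \<Longrightarrow> norm (v i) = 1"
  obtains g where "g > 0" "\<And>x. x \<bullet> v 1 = 0 \<Longrightarrow> (lam 1 + g) * (norm x)\<^sup>2 \<le> x \<bullet> (A *v x)"
proof -
  let ?I = "{1..CARD('n)}"
  have orth: "v i \<bullet> v j = 0" if "i \<in> ?I" "j \<in> ?I" "i \<noteq> j" for i j
  proof -
    have "lam j * (v i \<bullet> v j) = lam i * (v i \<bullet> v j)"
      using symmetric_matrix_inner[OF A, of "v i" "v j"] that by (simp add: eig)
    moreover have "lam i \<noteq> lam j"
      using strict_mono_on_imp_inj_on[OF lam] that by (auto dest: inj_onD)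
    ultimately show ?thesis by simp
  qed
  have inj: "inj_on v ?I"
  proof (rule inj_onI, rule ccontr)
    fix i j assume "i \<in> ?I" "j \<in> ?I" "v i = v j" "i \<noteq> j"
    then show False using orth[of i j] unit[of j] by (simp add: norm_eq_1)
  qed
  have po: "pairwise orthogonal (v ` ?I)"
    using orth unfolding pairwise_def orthogonal_def by blast
  have "0 \<notin> v ` ?I" using unit by fastforce
  then have "independent (v ` ?I)" using po by (rule pairwise_orthogonal_independent[rotated])
  moreover have "card (v ` ?I) = DIM(real^'n)" unfolding card_image[OF inj] by simp
  ultimately have sp: "span (v ` ?I) = UNIV"
    using card_eq_dim[of "v ` ?I" UNIV] by (auto simp: dim_UNIV)
  have expand: "(\<Sum>i\<in>?I. (v i \<bullet> x) *\<^sub>R v i) = x" for x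
  proof -
    have "(\<Sum>b\<in>v ` ?I. (x \<bullet> b) *\<^sub>R b) = x"
      using unit sp by (intro orthonormal_basis_expand[OF po]) auto
    then show ?thesis by (simp only: sum.reindex[OF inj] o_def inner_commute)
  qed
  have Ax: "x \<bullet> (A *v x) = (\<Sum>i\<in>?I. lam i * (v i \<bullet> x)\<^sup>2)" for x
  proof -
    have "x \<bullet> (A *v x) = (A *v x) \<bullet> (\<Sum>i\<in>?I. (v i \<bullet> x) *\<^sub>R v i)"
      unfolding expand by (rule inner_commute)
    also have "\<dots> = (\<Sum>i\<in>?I. (v i \<bullet> x) * (x \<bullet> (A *v v i)))"
      by (simp add: inner_sum_right symmetric_matrix_inner[OF A])
    also have "\<dots> = (\<Sum>i\<in>?I. lam i * (v i \<bullet> x)\<^sup>2)"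
      by (intro sum.cong refl) (simp add: eig inner_commute power2_eq_square)
    finally show ?thesis .
  qed
  have xx: "(norm x)\<^sup>2 = (\<Sum>i\<in>?I. (v i \<bullet> x)\<^sup>2)" for x
  proof -
    have "(norm x)\<^sup>2 = x \<bullet> (\<Sum>i\<in>?I. (v i \<bullet> x) *\<^sub>R v i)"
      unfolding expand by (rule power2_norm_eq_inner)
    then show ?thesis by (simp add: inner_sum_right inner_commute power2_eq_square)
  qed
  \<comment> \<open>In dimension one there is no second eigenvalue; the complement of
    \<open>v 1\<close> is then zero and any positive gap will do.\<close>
  define g where "g = (if CARD('n) = 1 then 1 else lam 2 - lam 1)"
  have "CARD('n) = 1 \<or> CARD('n) \<ge> 2"
    using zero_less_card_finite[where 'a = 'n] by linarith
  then have "g > 0"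
  proof
    assume "CARD('n) \<ge> 2"
    then show ?thesis using strict_mono_onD[OF lam, of 1 2] by (simp add: g_def)
  qed (simp add: g_def)
  moreover have lg: "lam 1 + g \<le> lam i" if "i \<in> ?I" "i \<noteq> 1" for i
    using that strict_mono_on_leD[OF lam, of 2 i] by (auto simp: g_def)
  have "(lam 1 + g) * (norm x)\<^sup>2 \<le> x \<bullet> (A *v x)" if "x \<bullet> v 1 = 0" for x
    unfolding Ax xx sum_distrib_left
  proof (rule sum_mono)
    fix i assume i: "i \<in> ?I"
    show "(lam 1 + g) * (v i \<bullet> x)\<^sup>2 \<le> lam i * (v i \<bullet> x)\<^sup>2"
      using that lg[OF i] by (cases "i = 1") (auto simp: inner_commute intro: mult_right_mono)
  qed
  ultimately show ?thesis by (rule that)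
qed

text \<open>A vector \<open>y\<close> orthogonal to \<open>u\<close> has a component along
  \<open>v\<close> of size at most \<open>norm y * norm (u - v)\<close>. This costs at most
  \<open>g * t\<^sup>2\<close> of the gap, and the Rayleigh quotient exceeds \<open>l\<close> only
  by a term quadratic in \<open>u - v\<close>. By \<open>close\<close> the two losses use up at most
  half of the gap.\<close>

lemma jac_coercive:
  fixes A :: "real^'n^'n"
  assumes A: "symmetric_matrix A" and v: "A *v v = l *\<^sub>R v" "norm v = 1" and g: "g > 0"
    and gap: "\<And>x. x \<bullet> v = 0 \<Longrightarrow> (l + g) * (norm x)\<^sup>2 \<le> x \<bullet> (A *v x)"
    and C: "\<And>x. norm (A *v x) \<le> C * norm x"
    and u: "norm u = 1" and close: "(g + C + \<bar>l\<bar>) * (norm (u - v))\<^sup>2 \<le> g / 2"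
    and y: "y \<bullet> u = 0"
  shows "g / 2 * (norm y)\<^sup>2 \<le> y \<bullet> (jac A u *v y)"
proof -
  define e where "e = u - v"
  define t where "t = y \<bullet> v"
  define y' where "y' = y - t *\<^sub>R v"
  have vv: "v \<bullet> v = 1" and uu: "u \<bullet> u = 1" using v u by (simp_all add: norm_eq_1)
  have "t = - (y \<bullet> e)" using y by (simp add: t_def e_def inner_diff_right)
  then have "\<bar>t\<bar> \<le> norm y * norm e"
    using Cauchy_Schwarz_ineq2[of y e] by simp
  then have t: "t\<^sup>2 \<le> (norm y)\<^sup>2 * (norm e)\<^sup>2"
    by (metis abs_ge_zero power2_abs power_mono power_mult_distrib)
  have vA: "v \<bullet> (A *v x) = l * (v \<bullet> x)" "x \<bullet> (A *v v) = l * (v \<bullet> x)" for x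
    using symmetric_matrix_inner[OF A, of v x] v(1) by (simp_all add: inner_commute)
  have "y' \<bullet> v = 0" by (simp add: y'_def t_def inner_diff_left vv)
  from gap[OF this] have "(l + g) * (norm y')\<^sup>2 \<le> y' \<bullet> (A *v y')" .
  moreover have "(norm y')\<^sup>2 = (norm y)\<^sup>2 - t\<^sup>2"
    unfolding power2_norm_eq_inner
    by (simp add: y'_def inner_diff_left inner_diff_right vv inner_commute[of v y] t_def[symmetric]
        power2_eq_square algebra_simps)
  moreover have "y' \<bullet> (A *v y') = y \<bullet> (A *v y) - l * t\<^sup>2"
    by (simp add: y'_def matrix_vector_mult_diff_distrib matrix_vector_mult_scaleR vA
        inner_diff_left inner_diff_right vv inner_commute[of v y] t_def[symmetric]
        power2_eq_square algebra_simps)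
  ultimately have 1: "y \<bullet> (A *v y) \<ge> (l + g) * (norm y)\<^sup>2 - g * t\<^sup>2"
    by (simp add: algebra_simps)
  \<comment> \<open>The first-order terms cancel because \<open>v\<close> is an eigenvector and both
    vectors have norm one.\<close>
  have "rayleigh A u - l = e \<bullet> (A *v e) - l * (e \<bullet> e)"
    by (simp add: rayleigh_def e_def matrix_vector_mult_diff_distrib vA
        inner_diff_left inner_diff_right vv uu inner_commute[of u v] algebra_simps)
  also have "\<dots> \<le> norm e * (C * norm e) + \<bar>l\<bar> * (norm e)\<^sup>2"
  proof -
    have "e \<bullet> (A *v e) \<le> norm e * (C * norm e)"
      by (rule order_trans[OF norm_cauchy_schwarz]) (intro mult_left_mono C norm_ge_zero)
    moreover have "- l * (e \<bullet> e) \<le> \<bar>l\<bar> * (norm e)\<^sup>2"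
      unfolding power2_norm_eq_inner by (intro mult_right_mono) auto
    ultimately show ?thesis by simp
  qed
  finally have 2: "rayleigh A u \<le> l + (C + \<bar>l\<bar>) * (norm e)\<^sup>2"
    by (simp add: power2_eq_square algebra_simps)
  have "rayleigh A u * (norm y)\<^sup>2 \<le> (l + (C + \<bar>l\<bar>) * (norm e)\<^sup>2) * (norm y)\<^sup>2"
    by (intro mult_right_mono 2) auto
  moreover have "g * t\<^sup>2 \<le> g * ((norm y)\<^sup>2 * (norm e)\<^sup>2)"
    using t g by simp
  moreover have "(g + C + \<bar>l\<bar>) * (norm e)\<^sup>2 * (norm y)\<^sup>2 \<le> g / 2 * (norm y)\<^sup>2"
    using close by (intro mult_right_mono) (auto simp: e_def)
  ultimately show ?thesis
    using 1 unfolding jac_form_perp[OF y] by (simp add: algebra_simps)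
qed

section \<open>Boundedness and Lipschitz continuity of the Jacobian in \<open>u\<close>\<close>

lemma norm_proj_perp_le:
  assumes "norm u = 1"
  shows "norm (proj_perp u *v y) \<le> 2 * norm y"
proof -
  have "norm ((u \<bullet> y) *\<^sub>R u) \<le> norm y"
    using Cauchy_Schwarz_ineq2[of u y] assms by simp
  then show ?thesis
    unfolding proj_perp_mult_vec using norm_triangle_ineq4[of y "(u \<bullet> y) *\<^sub>R u"] by linarith
qed

lemma norm_proj_perp_diff_le:
  assumes "norm u = 1" "norm w = 1"
  shows "norm (proj_perp u *v y - proj_perp w *v y) \<le> 2 * norm (u - w) * norm y"
proof -
  have "proj_perp u *v y - proj_perp w *v y = - ((u \<bullet> y) *\<^sub>R (u - w) + ((u - w) \<bullet> y) *\<^sub>R w)"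
    by (simp add: proj_perp_mult_vec inner_diff_left algebra_simps)
  then have "norm (proj_perp u *v y - proj_perp w *v y)
      = norm ((u \<bullet> y) *\<^sub>R (u - w) + ((u - w) \<bullet> y) *\<^sub>R w)" by (simp only: norm_minus_cancel)
  also have "\<dots> \<le> \<bar>u \<bullet> y\<bar> * norm (u - w) + \<bar>(u - w) \<bullet> y\<bar>"
    using norm_triangle_ineq[of "(u \<bullet> y) *\<^sub>R (u - w)" "((u - w) \<bullet> y) *\<^sub>R w"] assms by simp
  also have "\<dots> \<le> norm y * norm (u - w) + norm (u - w) * norm y"
    using Cauchy_Schwarz_ineq2[of u y] Cauchy_Schwarz_ineq2[of "u - w" y] assms
    by (intro add_mono mult_right_mono) auto
  finally show ?thesis by (simp add: mult_ac)
qed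

context
  fixes A :: "real^'n^'n" and C :: real
  assumes A: "symmetric_matrix A" and C: "\<And>x. norm (A *v x) \<le> C * norm x"
begin

lemma abs_rayleigh_le:
  assumes "norm u = 1"
  shows "\<bar>rayleigh A u\<bar> \<le> C"
  using Cauchy_Schwarz_ineq2[of u "A *v u"] C[of u] assms by (simp add: rayleigh_def)

lemma rayleigh_diff_le:
  assumes "norm u = 1" "norm w = 1"
  shows "\<bar>rayleigh A u - rayleigh A w\<bar> \<le> 2 * C * norm (u - w)"
proof -
  have "C \<ge> 0" using abs_rayleigh_le[OF assms(1)] by linarith
  have "\<bar>rayleigh A u - rayleigh A w\<bar> \<le> norm (u - w) * norm (A *v (u + w))"
    unfolding rayleigh_def symmetric_form_diff[OF A] by (rule Cauchy_Schwarz_ineq2)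
  also have "\<dots> \<le> norm (u - w) * (C * 2)"
    using norm_triangle_ineq[of u w] assms \<open>C \<ge> 0\<close>
    by (intro mult_left_mono order_trans[OF C] ) auto
  finally show ?thesis by (simp add: mult_ac)
qed

lemma shifted_mult_vec_le:
  assumes "norm u = 1"
  shows "norm (A *v x - rayleigh A u *\<^sub>R x) \<le> 2 * C * norm x"
proof -
  have "norm (rayleigh A u *\<^sub>R x) \<le> C * norm x"
    using abs_rayleigh_le[OF assms] by (simp add: mult_right_mono)
  then show ?thesis
    using norm_triangle_ineq4[of "A *v x" "rayleigh A u *\<^sub>R x"] C[of x] by simp
qed

lemma norm_jac_le:
  assumes u: "norm u = 1"
  shows "norm (jac A u *v y) \<le> 8 * C * norm y"
proof -
  have "C \<ge> 0" using abs_rayleigh_le[OF u] by linarith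
  have "norm (jac A u *v y) \<le> 2 * (2 * C * norm (proj_perp u *v y))"
    unfolding jac_mult_vec
    by (rule order_trans[OF norm_proj_perp_le[OF u]]) (intro mult_left_mono shifted_mult_vec_le u, simp)
  also have "\<dots> \<le> 2 * (2 * C * (2 * norm y))"
    using norm_proj_perp_le[OF u] \<open>C \<ge> 0\<close> by (intro mult_left_mono) auto
  finally show ?thesis by simp
qed

text \<open>First the outer projector is changed with the vector \<open>X\<close> fixed, at cost 8;
  then the inner part \<open>X - Y\<close> is compared, at cost 8 doubled by the outer projector.
  This adds up to 24.\<close>

lemma norm_jac_diff_le:
  assumes u: "norm u = 1" and w: "norm w = 1"
  shows "norm (jac A u *v y - jac A w *v y) \<le> 24 * C * norm (u - w) * norm y"
proof -
  have C0: "C \<ge> 0" using abs_rayleigh_le[OF u] by linarith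
  define d where "d = norm (u - w)"
  have d0: "d \<ge> 0" by (simp add: d_def)
  define S where "S z = A *v z - rayleigh A u *\<^sub>R z" for z
  define pu where "pu = proj_perp u *v y"
  define pw where "pw = proj_perp w *v y"
  define X where "X = S pu"
  define Y where "Y = A *v pw - rayleigh A w *\<^sub>R pw"
  have S: "norm (S z) \<le> 2 * C * norm z" for z
    unfolding S_def by (rule shifted_mult_vec_le[OF u])
  have pw: "norm pw \<le> 2 * norm y" and pu: "norm pu \<le> 2 * norm y"
    unfolding pu_def pw_def by (simp_all add: norm_proj_perp_le u w)
  have "X - Y = S (pu - pw) + (rayleigh A w - rayleigh A u) *\<^sub>R pw"
    by (simp add: X_def Y_def S_def matrix_vector_mult_diff_distrib algebra_simps)
  then have "norm (X - Y) \<le> norm (S (pu - pw)) + \<bar>rayleigh A w - rayleigh A u\<bar> * norm pw"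
    using norm_triangle_ineq[of "S (pu - pw)" "(rayleigh A w - rayleigh A u) *\<^sub>R pw"] by simp
  also have "\<dots> \<le> 2 * C * (2 * d * norm y) + (2 * C * d) * (2 * norm y)"
  proof (intro add_mono mult_mono)
    have "norm (pu - pw) \<le> 2 * d * norm y"
      unfolding pu_def pw_def d_def by (rule norm_proj_perp_diff_le[OF u w])
    then show "norm (S (pu - pw)) \<le> 2 * C * (2 * d * norm y)"
      using C0 by (intro order_trans[OF S] mult_left_mono) auto
    show "\<bar>rayleigh A w - rayleigh A u\<bar> \<le> 2 * C * d"
      using rayleigh_diff_le[OF w u] by (simp add: d_def norm_minus_commute)
  qed (use pw C0 d0 in auto)
  finally have XY: "norm (X - Y) \<le> 8 * C * d * norm y" by simp
  have "norm X \<le> 2 * C * (2 * norm y)"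
    unfolding X_def using C0 pu by (intro order_trans[OF S] mult_left_mono) auto
  then have X: "2 * d * norm X \<le> 2 * d * (2 * C * (2 * norm y))"
    using d0 by (intro mult_left_mono) auto
  have "jac A u *v y - jac A w *v y
      = (proj_perp u *v X - proj_perp w *v X) + proj_perp w *v (X - Y)"
    by (simp add: jac_mult_vec X_def Y_def S_def pu_def pw_def matrix_vector_mult_diff_distrib)
  then have "norm (jac A u *v y - jac A w *v y) \<le>
      norm (proj_perp u *v X - proj_perp w *v X) + norm (proj_perp w *v (X - Y))"
    by (metis norm_triangle_ineq)
  also have "\<dots> \<le> 2 * d * norm X + 2 * norm (X - Y)"
    unfolding d_def by (intro add_mono norm_proj_perp_diff_le norm_proj_perp_le u w)
  also have "\<dots> \<le> 24 * C * d * norm y"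
    using X XY by simp
  finally show ?thesis by (simp add: d_def)
qed

end

section \<open>Boundedness of the preconditioner and change of the Jacobian\<close>

text \<open>Split \<open>x\<close> into a multiple of \<open>u\<close> and an orthogonal part
  \<open>t = J y\<close>. The error inequality bounds the form at \<open>t\<close> by
  \<open>(1 + c) * (y \<bullet> t)\<close>, and coercivity bounds \<open>y\<close> by
  \<open>t\<close>. The inequality says nothing about the direction \<open>u\<close>, hence the
  separate term \<open>u \<bullet> (Q *v u)\<close>.\<close>

lemma form_bound_from_error:
  fixes J Q :: "real^'n^'n"
  assumes J: "psd J" and u: "norm u = 1" "J *v u = 0" and \<mu>: "\<mu> > 0"
    and coercive: "\<And>y. y \<bullet> u = 0 \<Longrightarrow> \<mu> * (norm y)\<^sup>2 \<le> y \<bullet> (J *v y)"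
    and Q: "psd Q" and c: "0 \<le> c"
    and bound: "\<And>y. \<bar>y \<bullet> (J *v y) - (J *v y) \<bullet> (Q *v (J *v y))\<bar> \<le> c * (y \<bullet> (J *v y))"
  shows "x \<bullet> (Q *v x) \<le> 2 * (u \<bullet> (Q *v u) + (1 + c) / \<mu>) * (norm x)\<^sup>2"
proof -
  define \<alpha> where "\<alpha> = u \<bullet> x"
  define t where "t = x - \<alpha> *\<^sub>R u"
  have x: "x = \<alpha> *\<^sub>R u + t" by (simp add: t_def)
  have t: "t \<bullet> u = 0"
    using u(1) by (simp add: t_def \<alpha>_def inner_diff_left norm_eq_1 inner_commute[of x u])
  have "y = 0" if "y \<bullet> u = 0" "J *v y = 0" for y
    using coercive[OF that(1)] that(2) \<mu> by (simp add: mult_le_0_iff)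
  then obtain y where y: "y \<bullet> u = 0" "J *v y = t"
    using perp_preimage[of J u t] J u t by (metis psd_def)
  have yt: "\<mu> * (norm y)\<^sup>2 \<le> y \<bullet> t" "y \<bullet> t \<le> norm y * norm t"
    using coercive[OF y(1)] y(2) norm_cauchy_schwarz[of y t] by auto
  have "\<mu> * norm y \<le> norm t"
  proof (cases "y = 0")
    case False
    have "norm y * (\<mu> * norm y) \<le> norm y * norm t"
      using yt by (simp add: power2_eq_square mult_ac)
    then show ?thesis using False by simp
  qed simp
  then have "norm y * norm t \<le> norm t / \<mu> * norm t"
    using \<mu> by (intro mult_right_mono) (auto simp: field_simps)
  then have "y \<bullet> t \<le> (norm t)\<^sup>2 / \<mu>"
    using yt(2) by (simp add: power2_eq_square)
  then have "(1 + c) * (y \<bullet> t) \<le> (1 + c) / \<mu> * (norm t)\<^sup>2"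
    using mult_left_mono[of "y \<bullet> t" "(norm t)\<^sup>2 / \<mu>" "1 + c"] c by simp
  moreover have "t \<bullet> (Q *v t) \<le> (1 + c) * (y \<bullet> t)"
    using bound[of y] y(2) by (simp add: algebra_simps)
  ultimately have tQ: "t \<bullet> (Q *v t) \<le> (1 + c) / \<mu> * (norm t)\<^sup>2" by linarith
  have norms: "(norm x)\<^sup>2 = \<alpha>\<^sup>2 + (norm t)\<^sup>2"
    unfolding power2_norm_eq_inner
    using t u(1) by (subst (1 2) x)
      (simp add: inner_add_left inner_add_right norm_eq_1 inner_commute[of u t] power2_eq_square)
  have "x \<bullet> (Q *v x) \<le> 2 * (\<alpha>\<^sup>2 * (u \<bullet> (Q *v u))) + 2 * (t \<bullet> (Q *v t))"
    using psd_form_add_le[OF Q, of "\<alpha> *\<^sub>R u" t]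
    by (simp add: x[symmetric] matrix_vector_mult_scaleR power2_eq_square)
  also have "\<dots> \<le> 2 * ((norm x)\<^sup>2 * (u \<bullet> (Q *v u))) + 2 * ((1 + c) / \<mu> * (norm x)\<^sup>2)"
  proof (intro add_mono mult_left_mono mult_right_mono)
    show "t \<bullet> (Q *v t) \<le> (1 + c) / \<mu> * (norm x)\<^sup>2"
      by (rule order_trans[OF tQ], rule mult_left_mono) (use norms c \<mu> in auto)
  qed (use norms Q in \<open>auto simp: psd_def\<close>)
  finally show ?thesis by (simp add: algebra_simps)
qed

text \<open>In the constant, 1 accounts for the change of the \<open>J\<close>-form,
  \<open>2 * N * B\<close> for that of the \<open>Q\<close>-form, and \<open>M\<close> for that of
  the right-hand side. Each change is a multiple of \<open>D * (norm y)\<^sup>2\<close>, which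
  coercivity of \<open>J'\<close> converts into a relative error.\<close>

lemma error_bound_transfer:
  fixes J J' Q :: "real^'n^'n"
  assumes Q: "psd Q" and N: "\<And>x. x \<bullet> (Q *v x) \<le> N * (norm x)\<^sup>2" "N \<ge> 0"
    and D: "norm (J' *v y - J *v y) \<le> D * norm y"
    and B: "norm (J *v y) \<le> B * norm y" "norm (J' *v y) \<le> B * norm y"
    and \<mu>: "\<mu> > 0" "\<mu> * (norm y)\<^sup>2 \<le> y \<bullet> (J' *v y)" and c: "0 \<le> c" "c \<le> M" and "D \<ge> 0" "B \<ge> 0"
    and bound: "\<bar>y \<bullet> (J *v y) - (J *v y) \<bullet> (Q *v (J *v y))\<bar> \<le> c * (y \<bullet> (J *v y))"
  shows "\<bar>y \<bullet> (J' *v y) - (J' *v y) \<bullet> (Q *v (J' *v y))\<bar>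
    \<le> (c + D * (1 + M + 2 * N * B) / \<mu>) * (y \<bullet> (J' *v y))"
proof -
  define n where "n = (norm y)\<^sup>2"
  have 1: "\<bar>y \<bullet> (J' *v y) - y \<bullet> (J *v y)\<bar> \<le> D * n"
  proof -
    have "\<bar>y \<bullet> (J' *v y - J *v y)\<bar> \<le> norm y * (D * norm y)"
      by (rule order_trans[OF Cauchy_Schwarz_ineq2]) (intro mult_left_mono D norm_ge_zero)
    then show ?thesis by (simp add: n_def power2_eq_square inner_diff_right mult_ac)
  qed
  have "\<bar>(J' *v y) \<bullet> (Q *v (J' *v y)) - (J *v y) \<bullet> (Q *v (J *v y))\<bar>
      \<le> N * norm (J' *v y - J *v y) * norm (J' *v y + J *v y)"
    by (rule psd_form_diff_bound[OF Q N(1)])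
  also have "\<dots> \<le> N * (D * norm y) * (B * norm y + B * norm y)"
    using B norm_triangle_ineq[of "J' *v y" "J *v y"] N(2) D \<open>D \<ge> 0\<close>
    by (intro mult_mono) auto
  also have "\<dots> = D * (2 * N * B) * n"
    by (simp add: n_def power2_eq_square algebra_simps)
  finally have 2: "\<bar>(J' *v y) \<bullet> (Q *v (J' *v y)) - (J *v y) \<bullet> (Q *v (J *v y))\<bar>
      \<le> D * (2 * N * B) * n" .
  have "c * (y \<bullet> (J *v y)) \<le> c * (y \<bullet> (J' *v y) + D * n)"
    using 1 c by (intro mult_left_mono) auto
  also have "\<dots> \<le> c * (y \<bullet> (J' *v y)) + M * (D * n)"
    using c \<open>D \<ge> 0\<close> by (simp add: distrib_left n_def mult_right_mono)
  finally have 3: "c * (y \<bullet> (J *v y)) \<le> c * (y \<bullet> (J' *v y)) + M * (D * n)" .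
  have "\<bar>y \<bullet> (J' *v y) - (J' *v y) \<bullet> (Q *v (J' *v y))\<bar>
      \<le> c * (y \<bullet> (J' *v y)) + M * (D * n) + D * n + D * (2 * N * B) * n"
    using 1 2 3 bound by linarith
  also have "\<dots> = c * (y \<bullet> (J' *v y)) + D * (1 + M + 2 * N * B) * n"
    by (simp add: algebra_simps)
  also have "\<dots> \<le> c * (y \<bullet> (J' *v y)) + D * (1 + M + 2 * N * B) * (y \<bullet> (J' *v y) / \<mu>)"
    using \<mu> c \<open>D \<ge> 0\<close> \<open>B \<ge> 0\<close> N(2)
    by (intro add_left_mono mult_left_mono) (auto simp: n_def field_simps)
  finally show ?thesis by (simp add: distrib_right)
qed

section \<open>The estimate along the Newton iteration\<close>

theorem theorem3p7:
  fixes A L :: "real^('n::{finite,linorder})^('n::{finite,linorder})"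
    and lam :: "nat \<Rightarrow> real"
    and v :: "nat \<Rightarrow> real^('n::{finite,linorder})"
    and r \<delta>\<^sub>0 :: real
  assumes "spd A"
    and "strict_mono_on {1..CARD('n)} lam"
    and "\<And>i. i \<in> {1..CARD('n)} \<Longrightarrow> A *v v i = lam i *\<^sub>R v i"
    and "\<And>i. i \<in> {1..CARD('n)} \<Longrightarrow> norm (v i) = 1"
    and "lower_triangular L"
    and "invertible L"
    and "r < 1"
    and "\<delta>\<^sub>0 > 0"
  shows "\<exists>\<delta>>0. \<exists>K. \<forall>u s.
           newton_iterates A u s \<longrightarrow>
           (\<forall>k. norm (u (Suc k) - v 1) < r * norm (u k - v 1)) \<longrightarrow>
           precond_error_norm A L u s 0 < \<delta>\<^sub>0 \<longrightarrow>
           norm (u 0 - v 1) < \<delta> \<longrightarrow>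
           (\<forall>k. precond_error_norm A L u s (Suc k)
                  \<le> precond_error_norm A L u s k + K * sqrt (norm (u k - v 1)))"
proof -
  have A: "symmetric_matrix A" using assms(1) by (simp add: spd_def)
  obtain g where g: "g > 0"
    and gap: "\<And>x. x \<bullet> v 1 = 0 \<Longrightarrow> (lam 1 + g) * (norm x)\<^sup>2 \<le> x \<bullet> (A *v x)"
    using eigenvalue_gap[OF A assms(2-4)] by blast
  have v1: "A *v v 1 = lam 1 *\<^sub>R v 1" "norm (v 1) = 1"
    using assms(3,4)[of 1] by (simp_all add: Suc_leI)
  define P\<^sub>0 where "P\<^sub>0 = matrix_inv (L ** transpose L)"
  define C where "C = onorm ((*v) A)"
  define a\<^sub>0 where "a\<^sub>0 = onorm ((*v) P\<^sub>0)"
  have C: "norm (A *v x) \<le> C * norm x" for x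
    unfolding C_def by (rule onorm) simp
  have C0: "C \<ge> 0" unfolding C_def by (rule onorm_pos_le) simp
  have a\<^sub>0: "norm (P\<^sub>0 *v x) \<le> a\<^sub>0 * norm x" for x
    unfolding a\<^sub>0_def by (rule onorm) simp
  have a\<^sub>00: "a\<^sub>0 \<ge> 0" unfolding a\<^sub>0_def by (rule onorm_pos_le) simp
  define \<mu> where "\<mu> = g / 2"
  \<comment> \<open>\<open>M\<close> and \<open>a\<^sub>0 + 1\<close> are to bound the error norms
    and the values \<open>u k \<bullet> (P k *v u k)\<close> for all \<open>k\<close>, each leaving
    one unit of room for drift. \<open>N\<close> is the resulting bound on the updated
    preconditioner. In \<open>K\<close>, 48 is the Lipschitz factor 24 times the 2 from
    \<open>norm (u (Suc k) - u k) \<le> 2 * e k\<close>, and \<open>8 * C\<close> bounds the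
    Jacobian.\<close>
  define M where "M = \<delta>\<^sub>0 + 1"
  define N where "N = 2 * (a\<^sub>0 + 1 + (1 + M) / \<mu>)"
  define K where "K = 48 * C * (1 + M + 2 * N * (8 * C)) / \<mu>"
  define G where "G = g + C + \<bar>lam 1\<bar>"
  have \<mu>: "\<mu> > 0" and M: "M > 0" and G: "G > 0"
    using g assms(8) C0 by (auto simp: \<mu>_def M_def G_def)
  have N: "N \<ge> 0" using \<mu> M a\<^sub>00 by (simp add: N_def)
  have K: "K \<ge> 0" using \<mu> M N C0 by (simp add: K_def)
  \<comment> \<open>The entry 1 gives \<open>e k \<le> sqrt (e k)\<close> and, with
    \<open>\<mu> / G\<close>, coercivity; the last two entries keep the accumulated drifts of the
    error norm and of \<open>a\<close> below 1.\<close>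
  define \<delta> where "\<delta> = Min {1, \<mu> / G, (1 - r) / (K + 1), (1 - r) / (4 * N + 1)}"
  have \<delta>: "\<delta> > 0" using \<mu> G K N assms(7) by (simp add: \<delta>_def)
  have \<delta>_le: "\<delta> \<le> 1" "\<delta> \<le> \<mu> / G" "\<delta> \<le> (1 - r) / (K + 1)" "\<delta> \<le> (1 - r) / (4 * N + 1)"
    unfolding \<delta>_def by (rule Min_le; simp)+
  have coercive: "\<mu> * (norm y)\<^sup>2 \<le> y \<bullet> (jac A w *v y)"
    if "norm w = 1" "norm (w - v 1) < \<delta>" "y \<bullet> w = 0" for w y
    unfolding \<mu>_def
  proof (rule jac_coercive[OF A v1 g gap C that(1) _ that(3)])
    have "(norm (w - v 1))\<^sup>2 \<le> 1 * \<delta>"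
      unfolding power2_eq_square using that(2) \<delta>_le by (intro mult_mono) auto
    also have "\<dots> \<le> \<mu> / G" using \<delta>_le by simp
    finally show "(g + C + \<bar>lam 1\<bar>) * (norm (w - v 1))\<^sup>2 \<le> g / 2"
      unfolding G_def[symmetric] using G by (simp add: \<mu>_def field_simps)
  qed
  have "\<forall>k. precond_error_norm A L u s (Suc k)
          \<le> precond_error_norm A L u s k + K * sqrt (norm (u k - v 1))"
    if newton: "newton_iterates A u s"
      and contr: "\<And>k. norm (u (Suc k) - v 1) < r * norm (u k - v 1)"
      and c0: "precond_error_norm A L u s 0 < \<delta>\<^sub>0" and e0: "norm (u 0 - v 1) < \<delta>" for u s
  proof -
    define e where "e k = norm (u k - v 1)" for k
    define P where "P k = precond_hat A L u s k" for k
    define J where "J k = jac A (u k)" for k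
    define c where "c k = precond_error_norm A L u s k" for k
    define a where "a k = u k \<bullet> (P k *v u k)" for k
    have su: "s k \<bullet> u k = 0" and Js: "residual A (u k) = - (J k *v s k)" and s0: "s k \<noteq> 0"
      and uS: "u (Suc k) = (1 / norm (u k + s k)) *\<^sub>R (u k + s k)" for k
      using newton by (simp_all add: newton_iterates_def J_def)
    have u1: "norm (u k) = 1" for k
    proof (induction k)
      case 0
      then show ?case using newton by (simp add: newton_iterates_def)
    next
      case (Suc k)
      have "u k + s k \<noteq> 0"
        using su[of k] Suc s0[of k]
        by (metis add.commute add_eq_0_iff inner_minus_right inner_eq_zero_iff neg_equal_0_iff_equal)
      then show ?case by (simp add: uS)
    qed
    have e_nonneg: "e k \<ge> 0" for k by (simp add: e_def)
    have eS: "e (Suc k) \<le> r * e k" for k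
      using contr[of k] by (simp add: e_def)
    have e_dec: "e (Suc k) \<le> e k" for k
      using eS[of k] mult_right_mono[of r 1 "e k"] assms(7) e_nonneg[of k] by linarith
    have e\<delta>: "e k < \<delta>" for k
      by (induction k) (use e0 e_dec in \<open>auto simp: e_def intro: le_less_trans\<close>)
    have coJ: "\<mu> * (norm y)\<^sup>2 \<le> y \<bullet> (J k *v y)" if "y \<bullet> u k = 0" for k y
      using coercive[OF u1 _ that] e\<delta>[of k] by (simp add: e_def J_def)
    have posJ: "0 < y \<bullet> (J k *v y)" if "y \<bullet> u k = 0" "y \<noteq> 0" for k y
      by (rule less_le_trans[OF _ coJ[OF that(1)]]) (use that(2) \<mu> in simp)
    have psdJ: "psd (J k)" for k
      unfolding J_def by (rule psd_jac[OF A u1])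
        (metis J_def posJ inner_zero_left less_imp_le order_refl)
    have Ju: "J k *v u k = 0" for k
      by (simp add: J_def jac_mult_self u1)
    have c: "c k = norm_perp (u k)
        (mat 1 - psd_sqrt (J k) ** (proj_perp (u k) ** P k ** proj_perp (u k)) ** psd_sqrt (J k))" for k
      by (simp add: c_def precond_error_norm_def precond_error_def precond_def J_def P_def)
    have cbound: "\<bar>y \<bullet> (J k *v y) - (J k *v y) \<bullet> (P k *v (J k *v y))\<bar> \<le> c k * (y \<bullet> (J k *v y))"
      for k y
      unfolding c by (rule norm_perp_error_bound[OF psdJ u1 Ju])
    \<comment> \<open>The sign is read off by testing at \<open>s k\<close>, a nonzero vector in the
      complement of \<open>u k\<close>.\<close>
    have c_nonneg: "c k \<ge> 0" for k
    proof -
      have "0 \<le> c k * (s k \<bullet> (J k *v s k))"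
        using cbound[of "s k" k] by linarith
      then show ?thesis using posJ[OF su s0, of k] by (simp add: zero_le_mult_iff)
    qed
    have PS: "P (Suc k) = bfgs_update (s k) (- (J k *v s k)) (P k)" for k
      by (simp add: P_def Js)
    have psdP: "psd (P k)" for k
    proof (induction k)
      case 0
      then show ?case using psd_inverse_mult_transpose[OF assms(6)] by (simp add: P_def)
    next
      case (Suc k)
      then show ?case
        unfolding PS using posJ[OF su s0] by (intro psd_bfgs_update) auto
    qed
    \<comment> \<open>Every correction in \<open>bfgs_form\<close> carries a factor
      \<open>s k \<bullet> u k\<close>, which is 0.\<close>
    have uPS: "u k \<bullet> (P (Suc k) *v u k) = a k" for k
      using su[of k] by (simp add: PS a_def bfgs_form)
    have du: "norm (u (Suc k) - u k) \<le> 2 * e k" for k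
      using norm_triangle_ineq4[of "u (Suc k) - v 1" "u k - v 1"] e_dec[of k] by (simp add: e_def)
    \<comment> \<open>The uniform bounds enter as hypotheses, so \<open>K\<close> and
      \<open>N\<close> do not depend on \<open>k\<close>; the induction for \<open>inv\<close>
      supplies them.\<close>
    have step: "c (Suc k) \<le> c k + K * e k \<and> a (Suc k) \<le> a k + 4 * N * e k"
      if ck: "c k \<le> M" and ak: "a k \<le> a\<^sub>0 + 1" for k
    proof
      have bound: "\<bar>y \<bullet> (J k *v y) - (J k *v y) \<bullet> (P (Suc k) *v (J k *v y))\<bar>
          \<le> c k * (y \<bullet> (J k *v y))" for y
        unfolding PS by (rule bfgs_secant_error[OF psdJ posJ[OF su s0] c_nonneg cbound])
      \<comment> \<open>The new preconditioner is bounded by means of the old \<open>J k\<close> and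
        \<open>u k\<close>, for which the error inequality and the value in direction
        \<open>u k\<close> are preserved by the update.\<close>
      have NP: "x \<bullet> (P (Suc k) *v x) \<le> N * (norm x)\<^sup>2" for x
      proof -
        have "x \<bullet> (P (Suc k) *v x) \<le> 2 * (a k + (1 + c k) / \<mu>) * (norm x)\<^sup>2"
          using form_bound_from_error[OF psdJ u1 Ju \<mu> coJ psdP c_nonneg bound] by (simp add: uPS)
        also have "\<dots> \<le> N * (norm x)\<^sup>2"
          unfolding N_def using ck ak \<mu>
          by (intro mult_right_mono mult_left_mono add_mono divide_right_mono) auto
        finally show ?thesis .
      qed
      have "a (Suc k) - a k \<le> N * norm (u (Suc k) - u k) * norm (u (Suc k) + u k)"
        using psd_form_diff_bound[OF psdP NP, of "u (Suc k)" "u k"] by (simp add: a_def[of "Suc k"] uPS)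
      also have "\<dots> \<le> N * (2 * e k) * 2"
        using du[of k] N e_nonneg[of k] norm_triangle_ineq[of "u (Suc k)" "u k"] u1
        by (intro mult_mono) auto
      finally show "a (Suc k) \<le> a k + 4 * N * e k" by simp
      show "c (Suc k) \<le> c k + K * e k"
        unfolding c[of "Suc k"]
      \<comment> \<open>Here \<open>s (Suc k)\<close> is the nonzero vector orthogonal to
        \<open>u (Suc k)\<close>.\<close>
      proof (rule norm_perp_error_le[OF psdJ u1 Ju posJ su s0])
        fix y assume y: "y \<bullet> u (Suc k) = 0"
        have D: "norm (J (Suc k) *v y - J k *v y) \<le> 48 * C * e k * norm y"
        proof -
          have "norm (J (Suc k) *v y - J k *v y) \<le> 24 * C * norm (u (Suc k) - u k) * norm y"
            unfolding J_def by (rule norm_jac_diff_le[OF A C u1 u1])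
          also have "\<dots> \<le> 24 * C * (2 * e k) * norm y"
            using du[of k] C0 by (intro mult_right_mono mult_left_mono) auto
          finally show ?thesis by simp
        qed
        have "\<bar>y \<bullet> (J (Suc k) *v y) - (J (Suc k) *v y) \<bullet> (P (Suc k) *v (J (Suc k) *v y))\<bar>
          \<le> (c k + 48 * C * e k * (1 + M + 2 * N * (8 * C)) / \<mu>) * (y \<bullet> (J (Suc k) *v y))"
          by (rule error_bound_transfer[OF psdP NP N D _ _ \<mu> coJ[OF y] c_nonneg ck _ _ bound])
             (use C0 e_nonneg norm_jac_le[OF A C u1] in \<open>auto simp: J_def\<close>)
        then show "\<bar>y \<bullet> (J (Suc k) *v y) - (J (Suc k) *v y) \<bullet> (P (Suc k) *v (J (Suc k) *v y))\<bar>
          \<le> (c k + K * e k) * (y \<bullet> (J (Suc k) *v y))"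
          by (simp add: K_def mult_ac)
      qed
    qed
    text \<open>Adding the tail \<open>e k / (1 - r)\<close> of the geometric series makes the bounds on \<open>c\<close> and \<open>a\<close>
      inductive.\<close>
    have tail: "b + B * e (Suc k) / (1 - r) \<le> b' + B * e k / (1 - r)"
      if "b \<le> b' + B * e k" "B \<ge> 0" for b b' B k
    proof -
      have "B * e (Suc k) / (1 - r) \<le> B * (r * e k) / (1 - r)"
        using eS[of k] that(2) assms(7) by (intro divide_right_mono mult_left_mono) auto
      moreover have "B * e k + B * (r * e k) / (1 - r) = B * e k / (1 - r)"
        using assms(7) by (simp add: field_simps)
      ultimately show ?thesis using that(1) by linarith
    qed
    \<comment> \<open>At \<open>k = 0\<close> this bounds the whole geometric tail by the unit of
      room in \<open>M\<close> and in \<open>a\<^sub>0 + 1\<close>.\<close>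
    have small: "B * e k / (1 - r) \<le> 1" if "\<delta> \<le> (1 - r) / (B + 1)" "B \<ge> 0" for B k
    proof -
      have "e k * (B + 1) \<le> \<delta> * (B + 1)"
        using that(2) e\<delta>[of k] by (intro mult_right_mono) auto
      also have "\<dots> \<le> 1 - r" using that by (simp add: pos_le_divide_eq)
      finally have "e k * (B + 1) \<le> 1 - r" .
      then have "B * e k \<le> 1 - r" using e_nonneg[of k] by (simp add: algebra_simps)
      then show ?thesis using assms(7) by simp
    qed
    have inv: "c k + K * e k / (1 - r) \<le> M \<and> a k + 4 * N * e k / (1 - r) \<le> a\<^sub>0 + 1" for k
    proof (induction k)
      case 0
      have "a 0 \<le> norm (u 0) * norm (P\<^sub>0 *v u 0)"
        by (simp add: a_def P_def P\<^sub>0_def[symmetric] norm_cauchy_schwarz)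
      then have "a 0 \<le> a\<^sub>0" using a\<^sub>0[of "u 0"] u1[of 0] by simp
      then show ?case
        using small[OF \<delta>_le(3) K, of 0] small[OF \<delta>_le(4), of 0] N c0 by (simp add: c_def M_def)
    next
      case (Suc k)
      have "K * e k / (1 - r) \<ge> 0" "4 * N * e k / (1 - r) \<ge> 0"
        using K N e_nonneg[of k] assms(7) by simp_all
      then have "c k \<le> M" "a k \<le> a\<^sub>0 + 1" using Suc by linarith+
      from step[OF this] have "c (Suc k) \<le> c k + K * e k" "a (Suc k) \<le> a k + 4 * N * e k"
        by blast+
      from tail[OF this(1) K] tail[OF this(2)] show ?case using Suc N by fastforce
    qed
    show ?thesis
    proof
      fix k
      have "K * e k / (1 - r) \<ge> 0" "4 * N * e k / (1 - r) \<ge> 0"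
        using K N e_nonneg[of k] assms(7) by simp_all
      then have "c k \<le> M" "a k \<le> a\<^sub>0 + 1" using inv[of k] by linarith+
      from step[OF this] have "c (Suc k) \<le> c k + K * e k" by blast
      \<comment> \<open>The increment is in fact linear in \<open>e k\<close>; the square root bound
        follows since \<open>e k \<le> 1\<close>.\<close>
      also have "K * e k \<le> K * sqrt (e k)"
      proof (rule mult_left_mono[OF _ K])
        have "e k \<le> 1" using e\<delta>[of k] \<delta>_le(1) by linarith
        then have "(e k)\<^sup>2 \<le> e k"
          using e_nonneg[of k] by (simp add: power2_eq_square mult_left_le)
        then show "e k \<le> sqrt (e k)" by (rule real_le_rsqrt)
      qed
      finally show "precond_error_norm A L u s (Suc k)
          \<le> precond_error_norm A L u s k + K * sqrt (norm (u k - v 1))"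
        by (simp add: c_def e_def)
    qed
  qed
  then show ?thesis using \<delta> by blast
qed

end
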